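(* There exists an ideal domain $P$ such that the set $\mathrm{Max}(P)$ of maximal elements of $P$ is not a $G_\delta$-set in the Scott space $\Sigma P=(P,\sigma(P))$.
   Context: Let $P$ be a poset. A nonempty subset $D\subseteq P$ is directed if every two elements of $D$ have an upper bound in $D$. $P$ is a dcpo if every directed subset $D$ has a supremum $\bigvee D$. For $x,y\in P$, $x\ll y$ (way-below) means: for each directed $D\subseteq P$ for which $\bigvee D$ exists, $y\le \bigvee D$ implies $x\le d$ for some $d\in D$. $P$ is continuous if for each $x\in P$ the set $\{y\in P: y\ll x\}$ is directed and has supremum $x$. A domain is a continuous dcpo. An element $a$ is compact if $a\ll a$. An element $x$ is maximal if the only $y\in P$ with $x\le y$ is $x$ itself; $\mathrm{Max}(P)$ denotes the set of maximal elements. A domain is called ideal if every element of it is either compact or maximal. A subset $U\subseteq P$ is Scott open if it is an upper set and, for each directed $D\subseteq P$ for which $\bigvee D$ exists, $\bigvee D\in U$ implies $D\cap U\ne\emptyset$. The Scott open sets form the Scott topology $\sigma(P)$. A subset of a topological space is a $G_\delta$-set if it is the intersection of a countable family of open sets. *)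

theory Defs
  imports "HOL-Analysis.FSigma" "HOL-Algebra.Order"
begin

text \<open>
  Posets are the partial orders of \<open>HOL-Algebra.Order\<close>, so the underlying set is an explicit carrier.
\<close>

definition directed_in :: "'a gorder \<Rightarrow> 'a set \<Rightarrow> bool" where
  "directed_in P D \<longleftrightarrow>
     D \<subseteq> carrier P \<and> D \<noteq> {} \<and>
     (\<forall>x\<in>D. \<forall>y\<in>D. \<exists>z\<in>D. x \<sqsubseteq>\<^bsub>P\<^esub> z \<and> y \<sqsubseteq>\<^bsub>P\<^esub> z)"

abbreviation is_Sup :: "'a gorder \<Rightarrow> 'a \<Rightarrow> 'a set \<Rightarrow> bool" where
  "is_Sup P s A \<equiv> least P s (Upper P A)"

definition dcpo :: "'a gorder \<Rightarrow> bool" where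
  "dcpo P \<longleftrightarrow> partial_order P \<and> (\<forall>D. directed_in P D \<longrightarrow> (\<exists>s. is_Sup P s D))"

definition way_below :: "'a gorder \<Rightarrow> 'a \<Rightarrow> 'a \<Rightarrow> bool" where
  "way_below P x y \<longleftrightarrow>
     x \<in> carrier P \<and> y \<in> carrier P \<and>
     (\<forall>D s. directed_in P D \<and> is_Sup P s D \<and> y \<sqsubseteq>\<^bsub>P\<^esub> s \<longrightarrow> (\<exists>d\<in>D. x \<sqsubseteq>\<^bsub>P\<^esub> d))"

definition continuous_poset :: "'a gorder \<Rightarrow> bool" where
  "continuous_poset P \<longleftrightarrow>
     partial_order P \<and>
     (\<forall>x\<in>carrier P. directed_in P {y \<in> carrier P. way_below P y x} \<and>
                    is_Sup P x {y \<in> carrier P. way_below P y x})"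

definition continuous_domain :: "'a gorder \<Rightarrow> bool" where
  "continuous_domain P \<longleftrightarrow> continuous_poset P \<and> dcpo P"

definition compact_element :: "'a gorder \<Rightarrow> 'a \<Rightarrow> bool" where
  "compact_element P a \<longleftrightarrow> way_below P a a"

definition Max_elements :: "'a gorder \<Rightarrow> 'a set" where
  "Max_elements P = {x \<in> carrier P. \<forall>y\<in>carrier P. x \<sqsubseteq>\<^bsub>P\<^esub> y \<longrightarrow> y = x}"

definition ideal_domain :: "'a gorder \<Rightarrow> bool" where
  "ideal_domain P \<longleftrightarrow>
     continuous_domain P \<and> (\<forall>x\<in>carrier P. compact_element P x \<or> x \<in> Max_elements P)"

definition scott_open :: "'a gorder \<Rightarrow> 'a set \<Rightarrow> bool" where
  "scott_open P U \<longleftrightarrow>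
     U \<subseteq> carrier P \<and>
     (\<forall>x\<in>U. \<forall>y\<in>carrier P. x \<sqsubseteq>\<^bsub>P\<^esub> y \<longrightarrow> y \<in> U) \<and>
     (\<forall>D s. directed_in P D \<and> is_Sup P s D \<and> s \<in> U \<longrightarrow> D \<inter> U \<noteq> {})"

definition scott_topology :: "'a gorder \<Rightarrow> 'a topology" where
  "scott_topology P = topology (scott_open P)"

lemma istopology_scott_open: "istopology (scott_open P)"
  unfolding istopology_def
proof (intro conjI allI impI)
  fix U V
  assume U: "scott_open P U" and V: "scott_open P V"
  have "D \<inter> (U \<inter> V) \<noteq> {}"
    if D: "directed_in P D" and s: "is_Sup P s D" and sU: "s \<in> U" and sV: "s \<in> V" for D s
  proof -
    obtain u where u: "u \<in> D" "u \<in> U"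
      using U D s sU unfolding scott_open_def by blast
    obtain v where v: "v \<in> D" "v \<in> V"
      using V D s sV unfolding scott_open_def by blast
    obtain z where z: "z \<in> D" "u \<sqsubseteq>\<^bsub>P\<^esub> z" "v \<sqsubseteq>\<^bsub>P\<^esub> z"
      using D u(1) v(1) unfolding directed_in_def by blast
    have "z \<in> carrier P"
      using D z(1) unfolding directed_in_def by blast
    then have "z \<in> U" "z \<in> V"
      using U V u(2) v(2) z(2,3) unfolding scott_open_def by blast+
    with z(1) show ?thesis by blast
  qed
  then show "scott_open P (U \<inter> V)"
    using U V unfolding scott_open_def by blast
next
  fix \<U>
  assume U: "\<forall>K\<in>\<U>. scott_open P K"
  show "scott_open P (\<Union>\<U>)"
    unfolding scott_open_def
  proof (intro conjI)
    show "\<Union>\<U> \<subseteq> carrier P"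
      using U unfolding scott_open_def by blast
    show "\<forall>x\<in>\<Union>\<U>. \<forall>y\<in>carrier P. x \<sqsubseteq>\<^bsub>P\<^esub> y \<longrightarrow> y \<in> \<Union>\<U>"
      using U unfolding scott_open_def by blast
    show "\<forall>D s. directed_in P D \<and> is_Sup P s D \<and> s \<in> \<Union>\<U> \<longrightarrow> D \<inter> \<Union>\<U> \<noteq> {}"
    proof (intro allI impI)
      fix D s
      assume D: "directed_in P D \<and> is_Sup P s D \<and> s \<in> \<Union>\<U>"
      then obtain K where K: "K \<in> \<U>" "s \<in> K" by blast
      then have "D \<inter> K \<noteq> {}"
        using U D unfolding scott_open_def by blast
      with K(1) show "D \<inter> \<Union>\<U> \<noteq> {}" by blast
    qed
  qed
qed

lemma openin_scott_topology [simp]: "openin (scott_topology P) U \<longleftrightarrow> scott_open P U"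
  by (simp add: scott_topology_def istopology_scott_open topology_inverse')

lemma topspace_scott_topology [simp]: "topspace (scott_topology P) = carrier P"
proof -
  have "scott_open P (carrier P)"
    unfolding scott_open_def directed_in_def by blast
  then show ?thesis
    unfolding topspace_def openin_scott_topology
    by (auto simp: scott_open_def)
qed

end

theory Submission
  imports Defs
begin

text \<open>
  The witness is built on the ordinal \<open>\<omega>\<^sub>1\<close>. Every limit ordinal \<open>a < \<omega>\<^sub>1\<close> is
  given a ladder, a strictly increasing \<open>\<omega>\<close>-sequence with supremum \<open>a\<close>. The elements of the
  poset are the intervals \<open>{ladder a k<..a}\<close>, called nodes, and the singletons \<open>{a}\<close>, called
  points, ordered by reverse inclusion.

  Along a directed family of nodes the right end can only decrease, so by well-foundedness it is
  eventually some constant \<open>a\<close>. Either the family has a greatest element, or it runs up the whole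
  ladder of \<open>a\<close> and its supremum is the point \<open>{a}\<close> (\<open>directed_without_greatest\<close>). Hence
  suprema exist, nodes are compact, points are exactly the maximal elements, and each point is the
  directed supremum of the nodes below it (\<open>ideal_domain_ladder_domain\<close>).

  A Scott open set \<open>U\<close> containing all points contains, for every limit \<open>a\<close>, some node
  \<open>{ladder a (k a)<..a}\<close>. The map taking \<open>a\<close> to \<open>ladder a (k a)\<close> is regressive, so
  it is bounded by a single \<open>b\<close> for arbitrarily large \<open>a\<close> (\<open>pressing_down\<close>). Every node
  whose left end is at least \<open>b\<close> is contained in one of these intervals, so it lies in \<open>U\<close>
  (\<open>open_around_points_contains_tails\<close>). Countably many such bounds \<open>b\<close> have a common upper
  bound in \<open>\<omega>\<^sub>1\<close>, so a countable intersection of open sets around the points still contains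
  nodes and cannot be the set of maximal elements.
\<close>

section \<open>The first uncountable ordinal as a type\<close>

definition wo :: "(nat \<Rightarrow> nat) rel" where
  "wo = (SOME r. well_order_on UNIV r)"

lemma well_order_wo: "well_order_on UNIV wo"
  unfolding wo_def using well_ordering by (metis someI_ex)

lemma wo_refl: "(x, x) \<in> wo"
  and wo_trans: "\<lbrakk>(x, y) \<in> wo; (y, z) \<in> wo\<rbrakk> \<Longrightarrow> (x, z) \<in> wo"
  and wo_antisym: "\<lbrakk>(x, y) \<in> wo; (y, x) \<in> wo\<rbrakk> \<Longrightarrow> x = y"
  and wo_total: "(x, y) \<in> wo \<or> (y, x) \<in> wo"
  and wf_wo: "wf (wo - Id)"
proof -
  have refl: "refl wo" and trans: "trans wo" and antisym: "antisym wo" and total: "total wo"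
    and "wf (wo - Id)"
    using well_order_wo unfolding order_on_defs by simp_all
  show "(x, x) \<in> wo" by (rule reflD[OF refl])
  show "\<lbrakk>(x, y) \<in> wo; (y, z) \<in> wo\<rbrakk> \<Longrightarrow> (x, z) \<in> wo" by (rule transD[OF trans])
  show "\<lbrakk>(x, y) \<in> wo; (y, x) \<in> wo\<rbrakk> \<Longrightarrow> x = y" by (rule antisymD[OF antisym])
  show "(x, y) \<in> wo \<or> (y, x) \<in> wo"
    using reflD[OF refl] total unfolding total_on_def by (cases "x = y") auto
  show "wf (wo - Id)" by fact
qed

lemma wo_minimal:
  assumes "x \<in> Q"
  shows "\<exists>z\<in>Q. \<forall>y\<in>Q. (z, y) \<in> wo"
  using wf_wo assms unfolding wf_eq_minimal
  by (metis DiffI wo_refl wo_total pair_in_Id_conv)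

text \<open>
  Under a well-order of an uncountable set, the elements with countable initial segment form a copy
  of \<open>\<omega>\<^sub>1\<close>. Carving it out of \<open>nat \<Rightarrow> nat\<close> is what lets the poset below be coded by
  such functions.
\<close>
definition countable_initial :: "(nat \<Rightarrow> nat) set" where
  "countable_initial = {x. countable {y. (y, x) \<in> wo}}"

lemma uncountable_functions: "uncountable (UNIV :: (nat \<Rightarrow> nat) set)"
proof
  assume "countable (UNIV :: (nat \<Rightarrow> nat) set)"
  then have "range (from_nat_into (UNIV :: (nat \<Rightarrow> nat) set)) = UNIV"
    by (simp add: range_from_nat_into)
  then obtain n where "from_nat_into UNIV n = (\<lambda>n. Suc (from_nat_into UNIV n n))"
    by (metis UNIV_I imageE)
  then show False
    by (metis n_not_Suc_n)
qed

text \<open>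
  The least element outside the set, if there is one, has only elements of the set before it, and
  by its choice there are uncountably many of these.
\<close>
lemma uncountable_initial: "uncountable countable_initial"
proof (cases "countable_initial = UNIV")
  case True
  then show ?thesis using uncountable_functions by simp
next
  case False
  then obtain x where x: "x \<notin> countable_initial" and
    least: "\<And>y. y \<notin> countable_initial \<Longrightarrow> (x, y) \<in> wo"
    using wo_minimal[of _ "- countable_initial"] by blast
  have "{y. (y, x) \<in> wo} \<subseteq> insert x countable_initial"
    using least wo_antisym by blast
  then show ?thesis
    using x countable_subset unfolding countable_initial_def by fastforce
qed

typedef omega1 = countable_initial
  using uncountable_initial by (metis countable_empty ex_in_conv)

instantiation omega1 :: wellorder
begin

definition less_eq_omega1 :: "omega1 \<Rightarrow> omega1 \<Rightarrow> bool" where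
  "a \<le> b \<longleftrightarrow> (Rep_omega1 a, Rep_omega1 b) \<in> wo"

definition less_omega1 :: "omega1 \<Rightarrow> omega1 \<Rightarrow> bool" where
  "(a :: omega1) < b \<longleftrightarrow> a \<le> b \<and> \<not> b \<le> a"

instance
proof
  fix a b c :: omega1
  show "a < b \<longleftrightarrow> a \<le> b \<and> \<not> b \<le> a"
    by (rule less_omega1_def)
  show "a \<le> a"
    by (simp add: less_eq_omega1_def wo_refl)
  show "a \<le> c" if "a \<le> b" "b \<le> c"
    using that wo_trans unfolding less_eq_omega1_def by blast
  show "a = b" if "a \<le> b" "b \<le> a"
    using that wo_antisym Rep_omega1_inject unfolding less_eq_omega1_def by blast
  show "a \<le> b \<or> b \<le> a"
    using wo_total unfolding less_eq_omega1_def by blast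
next
  fix P :: "omega1 \<Rightarrow> bool" and a
  assume step: "\<And>x. (\<And>y. y < x \<Longrightarrow> P y) \<Longrightarrow> P x"
  show "P a"
  proof (rule ccontr)
    assume "\<not> P a"
    then obtain z where "z \<in> Rep_omega1 ` {x. \<not> P x}"
      and min: "\<forall>y \<in> Rep_omega1 ` {x. \<not> P x}. (z, y) \<in> wo"
      using wo_minimal[of "Rep_omega1 a" "Rep_omega1 ` {x. \<not> P x}"] by blast
    then obtain x where "\<not> P x" "z = Rep_omega1 x" by blast
    with min step[of x] show False
      unfolding less_omega1_def less_eq_omega1_def by blast
  qed
qed

end

text \<open>
  The initial segments up to the members of a sequence cover only countably much. Besides
  well-foundedness, uncountable cofinality is all that the argument takes from \<open>\<omega>\<^sub>1\<close>.
\<close>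
lemma omega1_sequence_bounded:
  fixes s :: "nat \<Rightarrow> omega1"
  shows "\<exists>b. \<forall>n. s n < b"
proof -
  have "countable (\<Union>n. {y. (y, Rep_omega1 (s n)) \<in> wo})"
    using Rep_omega1 unfolding countable_initial_def by blast
  then have "\<not> countable_initial \<subseteq> (\<Union>n. {y. (y, Rep_omega1 (s n)) \<in> wo})"
    using uncountable_initial countable_subset by metis
  then obtain w where "w \<in> countable_initial" "\<And>n. (w, Rep_omega1 (s n)) \<notin> wo"
    by auto
  then show ?thesis
    by (metis Abs_omega1_inverse less_eq_omega1_def not_le)
qed

section \<open>Ladders and pressing down\<close>

definition is_ladder :: "(nat \<Rightarrow> omega1) \<Rightarrow> omega1 \<Rightarrow> bool" where
  "is_ladder c a \<longleftrightarrow> strict_mono c \<and> (\<forall>k. c k < a) \<and> (\<forall>b<a. \<exists>k. b < c k)"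

definition limit :: "omega1 \<Rightarrow> bool" where
  "limit a \<longleftrightarrow> (\<exists>c. is_ladder c a)"

definition ladder :: "omega1 \<Rightarrow> nat \<Rightarrow> omega1" where
  "ladder a = (SOME c. is_ladder c a)"

lemma is_ladder_ladder: "limit a \<Longrightarrow> is_ladder (ladder a) a"
  unfolding limit_def ladder_def by (rule someI_ex[of "\<lambda>c. is_ladder c a"])

lemma strict_mono_ladder: "limit a \<Longrightarrow> strict_mono (ladder a)"
  and ladder_less: "limit a \<Longrightarrow> ladder a k < a"
  and ladder_cofinal: "\<lbrakk>limit a; b < a\<rbrakk> \<Longrightarrow> \<exists>k. b < ladder a k"
  using is_ladder_ladder unfolding is_ladder_def by blast+

lemma strict_mono_has_limit:
  fixes s :: "nat \<Rightarrow> omega1"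
  assumes "strict_mono s"
  obtains a where "is_ladder s a"
proof
  let ?a = "LEAST b. \<forall>n. s n < b"
  have "\<forall>n. s n < ?a"
    using omega1_sequence_bounded by (rule LeastI_ex)
  moreover have "\<exists>k. b < s k" if b: "b < ?a" for b
  proof -
    obtain k where "b \<le> s k" using not_less_Least[OF b] by (meson not_le)
    also have "s k < s (Suc k)" using assms by (simp add: strict_mono_def)
    finally show ?thesis by blast
  qed
  ultimately show "is_ladder s ?a"
    using assms unfolding is_ladder_def by blast
qed

text \<open>
  The closure argument behind Fodor's lemma. If every bound \<open>b\<close> failed beyond some \<open>h b\<close>,
  then the supremum of an \<open>\<omega>\<close>-sequence closed under \<open>h\<close> would be a limit point at which \<open>g\<close>
  exceeds everything below it, so \<open>g\<close> would not be regressive there.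
\<close>
lemma pressing_down:
  assumes regressive: "\<And>a. limit a \<Longrightarrow> g a < a"
  shows "\<exists>b. \<forall>c. \<exists>a\<ge>c. limit a \<and> g a \<le> b"
proof (rule ccontr)
  assume "\<not> ?thesis"
  then obtain h where h: "\<And>b a. \<lbrakk>h b \<le> a; limit a\<rbrakk> \<Longrightarrow> b < g a"
    by (metis not_le)
  have "\<exists>y. x < y \<and> h x \<le> y" for x
    using omega1_sequence_bounded[of "\<lambda>n. max x (h x)"] by (auto intro: less_imp_le)
  then obtain f where f: "\<And>x. x < f x \<and> h x \<le> f x"
    by metis
  (* The starting point is immaterial. *)
  define s where "s n = (f ^^ n) undefined" for n
  have s_Suc: "s (Suc n) = f (s n)" for n
    by (simp add: s_def)
  then have mono: "strict_mono s"
    using f by (simp add: strict_mono_Suc_iff)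
  then obtain a where a: "is_ladder s a"
    by (rule strict_mono_has_limit)
  then have lim: "limit a"
    unfolding limit_def by blast
  then obtain k where k: "g a < s k"
    using a regressive unfolding is_ladder_def by blast
  have "h (s k) \<le> s (Suc k)"
    using f s_Suc by simp
  also have "s (Suc k) \<le> a"
    using a unfolding is_ladder_def by (simp add: less_imp_le)
  finally show False
    using h[OF _ lim] k by fastforce
qed

lemma limit_above: obtains a where "limit a" "b < a"
proof -
  obtain f :: "omega1 \<Rightarrow> omega1" where f: "\<And>x. x < f x"
    using omega1_sequence_bounded[of "\<lambda>n. x" for x] by metis
  define s where "s n = (f ^^ n) b" for n
  have "strict_mono s"
    using f by (simp add: strict_mono_Suc_iff s_def)
  then obtain a where "is_ladder s a"
    by (rule strict_mono_has_limit)
  moreover have "s 0 = b" by (simp add: s_def)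
  ultimately show ?thesis
    using that unfolding limit_def is_ladder_def by metis
qed

section \<open>Ideal domains from nodes and points\<close>

lemma is_Sup_iff:
  assumes "D \<subseteq> carrier P"
  shows "is_Sup P s D \<longleftrightarrow> s \<in> carrier P \<and> (\<forall>d\<in>D. d \<sqsubseteq>\<^bsub>P\<^esub> s) \<and>
    (\<forall>u\<in>carrier P. (\<forall>d\<in>D. d \<sqsubseteq>\<^bsub>P\<^esub> u) \<longrightarrow> s \<sqsubseteq>\<^bsub>P\<^esub> u)"
proof -
  have "Upper P D = {u \<in> carrier P. \<forall>d\<in>D. d \<sqsubseteq>\<^bsub>P\<^esub> u}"
    using assms unfolding Upper_def by blast
  then show ?thesis unfolding least_def by auto
qed

text \<open>
  Here \<open>K\<close> is to become the set of compact elements. The assumption on a directed set without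
  greatest element says that its supremum adds nothing of \<open>K\<close> that was not already reached, which is
  compactness of the members of \<open>K\<close>; for directed sets with a greatest element compactness is
  automatic.
\<close>
lemma ideal_domain_criterion:
  assumes po: "partial_order P" and K: "K \<subseteq> carrier P"
    and max: "carrier P - K \<subseteq> Max_elements P"
    and approx: "\<And>m. m \<in> carrier P - K \<Longrightarrow>
      directed_in P {k \<in> K. k \<sqsubseteq>\<^bsub>P\<^esub> m} \<and> is_Sup P m {k \<in> K. k \<sqsubseteq>\<^bsub>P\<^esub> m}"
    and dir: "\<And>D. \<lbrakk>directed_in P D; \<not> (\<exists>g\<in>D. \<forall>d\<in>D. d \<sqsubseteq>\<^bsub>P\<^esub> g)\<rbrakk> \<Longrightarrow>
      \<exists>m. is_Sup P m D \<and> (\<forall>k\<in>K. k \<sqsubseteq>\<^bsub>P\<^esub> m \<longrightarrow> (\<exists>d\<in>D. k \<sqsubseteq>\<^bsub>P\<^esub> d))"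
  shows "ideal_domain P"
proof -
  interpret partial_order P by (rule po)
  have sup_greatest: "is_Sup P g D" if "directed_in P D" "g \<in> D" "\<forall>d\<in>D. d \<sqsubseteq>\<^bsub>P\<^esub> g" for D g
    using that is_Sup_iff[of D P g] unfolding directed_in_def by blast
  have dcpo: "dcpo P"
    unfolding dcpo_def using po dir sup_greatest by metis
  have compact: "way_below P k k" if "k \<in> K" for k
    unfolding way_below_def
  proof (intro conjI allI impI)
    show "k \<in> carrier P" "k \<in> carrier P" using that K by auto
    fix D s assume "directed_in P D \<and> is_Sup P s D \<and> k \<sqsubseteq>\<^bsub>P\<^esub> s"
    then have D: "directed_in P D" and s: "is_Sup P s D" and le: "k \<sqsubseteq>\<^bsub>P\<^esub> s" by auto
    show "\<exists>d\<in>D. k \<sqsubseteq>\<^bsub>P\<^esub> d"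
    proof (cases "\<exists>g\<in>D. \<forall>d\<in>D. d \<sqsubseteq>\<^bsub>P\<^esub> g")
      case True
      then obtain g where "g \<in> D" "\<forall>d\<in>D. d \<sqsubseteq>\<^bsub>P\<^esub> g" by blast
      then have "s = g"
        using sup_greatest[OF D] s least_unique by blast
      then show ?thesis using le \<open>g \<in> D\<close> by blast
    next
      case False
      then obtain m where "is_Sup P m D" "\<forall>k\<in>K. k \<sqsubseteq>\<^bsub>P\<^esub> m \<longrightarrow> (\<exists>d\<in>D. k \<sqsubseteq>\<^bsub>P\<^esub> d)"
        using dir[OF D] by blast
      moreover then have "m = s" using s least_unique by blast
      ultimately show ?thesis using that le by blast
    qed
  qed
  have wb_le: "y \<sqsubseteq>\<^bsub>P\<^esub> x" if "way_below P y x" for y x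
  proof -
    have "x \<in> carrier P" using that unfolding way_below_def by blast
    then have "directed_in P {x}" "is_Sup P x {x}"
      by (auto simp: directed_in_def is_Sup_iff)
    then show ?thesis using that \<open>x \<in> carrier P\<close> unfolding way_below_def by blast
  qed
  have wb_trans: "way_below P k x" if k: "k \<in> K" and x: "x \<in> carrier P" "k \<sqsubseteq>\<^bsub>P\<^esub> x" for k x
    unfolding way_below_def
  proof (intro conjI allI impI)
    show "k \<in> carrier P" "x \<in> carrier P" using k K x by auto
    fix D s assume Ds: "directed_in P D \<and> is_Sup P s D \<and> x \<sqsubseteq>\<^bsub>P\<^esub> s"
    then have "s \<in> carrier P" unfolding least_def by blast
    then have "k \<sqsubseteq>\<^bsub>P\<^esub> s" using Ds x k K le_trans by blast
    then show "\<exists>d\<in>D. k \<sqsubseteq>\<^bsub>P\<^esub> d"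
      using compact[OF k] Ds unfolding way_below_def by blast
  qed
  have approx': "directed_in P {y \<in> carrier P. way_below P y x} \<and>
      is_Sup P x {y \<in> carrier P. way_below P y x}" if x: "x \<in> carrier P" for x
  proof (cases "x \<in> K")
    case True
    then have g: "x \<in> {y \<in> carrier P. way_below P y x}" using compact x by blast
    then have "directed_in P {y \<in> carrier P. way_below P y x}"
      using wb_le unfolding directed_in_def by blast
    then show ?thesis using sup_greatest g wb_le by blast
  next
    case False
    have "y \<in> K" if y: "way_below P y x" for y
    proof (rule ccontr)
      assume "y \<notin> K"
      have "y \<in> carrier P" using y unfolding way_below_def by blast
      then have "y \<in> Max_elements P" using max \<open>y \<notin> K\<close> by blast
      (* A maximal y below x is x itself, and x is not compact: it would lie below a member of K. *)
      then have "x = y" using wb_le[OF y] x unfolding Max_elements_def by blast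
      then have "way_below P x x" using y by simp
      moreover have "directed_in P {k \<in> K. k \<sqsubseteq>\<^bsub>P\<^esub> x} \<and> is_Sup P x {k \<in> K. k \<sqsubseteq>\<^bsub>P\<^esub> x} \<and> x \<sqsubseteq>\<^bsub>P\<^esub> x"
        using approx[of x] x False by simp
      ultimately have "\<exists>k\<in>{k \<in> K. k \<sqsubseteq>\<^bsub>P\<^esub> x}. x \<sqsubseteq>\<^bsub>P\<^esub> k"
        unfolding way_below_def by blast
      then obtain k where "k \<in> K" "k \<sqsubseteq>\<^bsub>P\<^esub> x" "x \<sqsubseteq>\<^bsub>P\<^esub> k"
        by blast
      then have "k = x" using le_antisym x K by blast
      then show False using \<open>k \<in> K\<close> False by blast
    qed
    then have "{y \<in> carrier P. way_below P y x} = {k \<in> K. k \<sqsubseteq>\<^bsub>P\<^esub> x}"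
      using wb_le wb_trans[OF _ x] K by blast
    then show ?thesis using approx x False by simp
  qed
  show ?thesis
    unfolding ideal_domain_def continuous_domain_def continuous_poset_def compact_element_def
    using po dcpo approx' compact max by blast
qed

section \<open>The ladder domain\<close>

text \<open>
  The first value of a code separates points from the nodes of each index; the remaining values spell
  out the right end.
\<close>
definition point :: "omega1 \<Rightarrow> nat \<Rightarrow> nat" where
  "point a = case_nat 0 (Rep_omega1 a)"

definition node :: "omega1 \<Rightarrow> nat \<Rightarrow> nat \<Rightarrow> nat" where
  "node a k = case_nat (Suc k) (Rep_omega1 a)"

definition nbhd :: "(nat \<Rightarrow> nat) \<Rightarrow> omega1 set" where
  "nbhd f = (let a = Abs_omega1 (\<lambda>n. f (Suc n)) in
     case f 0 of 0 \<Rightarrow> {a} | Suc k \<Rightarrow> {ladder a k<..a})"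

lemma nbhd_point [simp]: "nbhd (point a) = {a}"
  by (simp add: nbhd_def point_def Rep_omega1_inverse)

lemma nbhd_node [simp]: "nbhd (node a k) = {ladder a k<..a}"
  by (simp add: nbhd_def node_def Rep_omega1_inverse)

definition points :: "(nat \<Rightarrow> nat) set" where
  "points = {point a | a. limit a}"

definition nodes :: "(nat \<Rightarrow> nat) set" where
  "nodes = {node a k | a k. limit a}"

definition ladder_domain :: "(nat \<Rightarrow> nat) gorder" where
  "ladder_domain = \<lparr>carrier = nodes \<union> points, eq = (=), le = (\<lambda>x y. nbhd y \<subseteq> nbhd x)\<rparr>"

lemma carrier_ladder_domain [simp]: "carrier ladder_domain = nodes \<union> points"
  and eq_ladder_domain [simp]: "x .=\<^bsub>ladder_domain\<^esub> y \<longleftrightarrow> x = y"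
  and le_ladder_domain [simp]: "x \<sqsubseteq>\<^bsub>ladder_domain\<^esub> y \<longleftrightarrow> nbhd y \<subseteq> nbhd x"
  by (simp_all add: ladder_domain_def)

lemma node_in [simp]: "limit a \<Longrightarrow> node a k \<in> nodes"
  and point_in [simp]: "limit a \<Longrightarrow> point a \<in> points"
  unfolding nodes_def points_def by blast+

lemma ladder_le_iff: "limit a \<Longrightarrow> ladder a k \<le> ladder a l \<longleftrightarrow> k \<le> l"
  using strict_mono_ladder strict_mono_less_eq by blast

text \<open>
  The lower end of the larger interval is compared through a membership argument: if it exceeded
  the lower end of the smaller interval, it would belong to that interval but not to its own.
\<close>
lemma nbhd_node_subset_iff:
  assumes "limit a" "limit b"
  shows "nbhd (node b l) \<subseteq> nbhd (node a k) \<longleftrightarrow> b \<le> a \<and> ladder a k \<le> ladder b l"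
proof
  assume sub: "nbhd (node b l) \<subseteq> nbhd (node a k)"
  have "b \<in> nbhd (node b l)" using ladder_less[OF assms(2)] by simp
  then have "b \<le> a" using sub by auto
  moreover have "ladder a k \<le> ladder b l"
  proof (rule ccontr)
    assume "\<not> ladder a k \<le> ladder b l"
    moreover have "ladder a k < b" using \<open>b \<in> nbhd (node b l)\<close> sub by auto
    ultimately have "ladder a k \<in> nbhd (node b l)" by auto
    then show False using sub by auto
  qed
  ultimately show "b \<le> a \<and> ladder a k \<le> ladder b l" by blast
qed auto

text \<open>The next rung of the ladder lies strictly between the two ends of the interval.\<close>
lemma nbhd_node_not_subset_point:
  assumes "limit a"
  shows "\<not> nbhd (node a k) \<subseteq> {b}"
proof -
  have "ladder a k < ladder a (Suc k)"
    using strict_mono_ladder[OF assms] by (simp add: strict_mono_def)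
  then have "{ladder a (Suc k), a} \<subseteq> nbhd (node a k)"
    using ladder_less[OF assms] by (auto intro: less_imp_le)
  moreover have "ladder a (Suc k) \<noteq> a" using ladder_less[OF assms, of "Suc k"] by simp
  ultimately show ?thesis by (metis insert_subset singletonD subset_trans)
qed

lemma nbhd_nonempty: "x \<in> nodes \<union> points \<Longrightarrow> nbhd x \<noteq> {}"
  using nbhd_node_not_subset_point unfolding nodes_def points_def by fastforce

lemma inj_on_nbhd: "inj_on nbhd (nodes \<union> points)"
proof (rule inj_onI)
  fix x y assume xy: "x \<in> nodes \<union> points" "y \<in> nodes \<union> points" and eq: "nbhd x = nbhd y"
  have node_point: False if "limit a" "nbhd (node a k) = nbhd (point b)" for a k b
    using nbhd_node_not_subset_point[OF that(1), of k b] that(2) by simp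
  have node_node: "node a k = node b l"
    if "limit a" "limit b" "nbhd (node a k) = nbhd (node b l)" for a b k l
  proof -
    have "a = b" using nbhd_node_subset_iff that by (metis antisym subset_refl)
    moreover then have "k = l" using nbhd_node_subset_iff ladder_le_iff that by (metis antisym subset_refl)
    ultimately show ?thesis by simp
  qed
  have point_point: "point a = point b" if "nbhd (point a) = nbhd (point b)" for a b
    using that by simp
  show "x = y"
    using xy eq node_point node_node point_point unfolding nodes_def points_def
    by clarsimp (metis nbhd_node nbhd_point singleton_inject)
qed

lemma partial_order_ladder_domain: "partial_order ladder_domain"
proof
  show "x .=\<^bsub>ladder_domain\<^esub> y" if "x \<sqsubseteq>\<^bsub>ladder_domain\<^esub> y" "y \<sqsubseteq>\<^bsub>ladder_domain\<^esub> x"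
    "x \<in> carrier ladder_domain" "y \<in> carrier ladder_domain" for x y
    using that inj_on_nbhd unfolding inj_on_def by auto
  show "(.=\<^bsub>ladder_domain\<^esub>) = (=)"
    by (simp add: ladder_domain_def)
qed auto

lemma point_is_max: "point a \<in> Max_elements ladder_domain" if "limit a"
  unfolding Max_elements_def
proof (intro CollectI conjI ballI impI)
  fix y assume y: "y \<in> carrier ladder_domain" "point a \<sqsubseteq>\<^bsub>ladder_domain\<^esub> y"
  then have "nbhd y = nbhd (point a)"
    using nbhd_nonempty[of y] by auto
  then show "y = point a"
    using inj_on_nbhd y that unfolding inj_on_def by simp
qed (use that in simp)

lemma Max_ladder_domain: "Max_elements ladder_domain = points"
proof
  show "points \<subseteq> Max_elements ladder_domain"
    using point_is_max unfolding points_def by blast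
  have "node a k \<notin> Max_elements ladder_domain" if "limit a" for a k
  proof
    assume "node a k \<in> Max_elements ladder_domain"
    moreover have "node a k \<sqsubseteq>\<^bsub>ladder_domain\<^esub> point a"
      using that ladder_less by simp
    ultimately have "point a = node a k"
      using that unfolding Max_elements_def by simp
    then show False
      using nbhd_node_not_subset_point[OF that, of k a] by (metis nbhd_point subset_refl)
  qed
  moreover have "Max_elements ladder_domain \<subseteq> nodes \<union> points"
    unfolding Max_elements_def by auto
  ultimately show "Max_elements ladder_domain \<subseteq> points"
    unfolding nodes_def by blast
qed

text \<open>
  The nodes on cofinally many rungs intersect in \<open>{a}\<close> alone, so any other upper bound denotes a
  subset of \<open>{a}\<close>.
\<close>
lemma is_Sup_point:
  assumes a: "limit a" and D: "D \<subseteq> carrier ladder_domain"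
    and ub: "\<And>d. d \<in> D \<Longrightarrow> d \<sqsubseteq>\<^bsub>ladder_domain\<^esub> point a"
    and cofinal: "\<And>k. \<exists>l\<ge>k. node a l \<in> D"
  shows "is_Sup ladder_domain (point a) D"
  unfolding is_Sup_iff[OF D]
proof (intro conjI ballI impI)
  show "point a \<in> carrier ladder_domain" using a by simp
  show "d \<sqsubseteq>\<^bsub>ladder_domain\<^esub> point a" if "d \<in> D" for d using ub that .
  fix u assume u: "u \<in> carrier ladder_domain" "\<forall>d\<in>D. d \<sqsubseteq>\<^bsub>ladder_domain\<^esub> u"
  have "x = a" if "x \<in> nbhd u" for x
  proof (rule ccontr)
    assume "x \<noteq> a"
    obtain l0 where "node a l0 \<in> D" using cofinal by blast
    then have "x \<le> a" using u that by fastforce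
    then obtain k where k: "x < ladder a k"
      using \<open>x \<noteq> a\<close> ladder_cofinal[OF a] by (metis order.not_eq_order_implies_strict)
    obtain l where l: "k \<le> l" "node a l \<in> D" using cofinal by blast
    then have "ladder a l < x" using u that by fastforce
    then show False
      using k l(1) ladder_le_iff[OF a] by (metis leD order.strict_trans1 less_imp_le)
  qed
  then show "point a \<sqsubseteq>\<^bsub>ladder_domain\<^esub> u" by auto
qed

text \<open>
  The lower end of \<open>x\<close> is less than \<open>a\<close>, so the ladder of \<open>a\<close> eventually passes it. This one fact
  gives both directedness of the nodes below a point and their compactness.
\<close>
lemma node_below_point:
  assumes a: "limit a" and x: "x \<in> nodes" "x \<sqsubseteq>\<^bsub>ladder_domain\<^esub> point a"
  obtains k where "\<And>l. k \<le> l \<Longrightarrow> x \<sqsubseteq>\<^bsub>ladder_domain\<^esub> node a l"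
proof -
  obtain b j where b: "limit b" "x = node b j" using x unfolding nodes_def by blast
  then have "ladder b j < a" "a \<le> b" using x by auto
  then obtain k where k: "ladder b j < ladder a k" using ladder_cofinal[OF a] by blast
  have "x \<sqsubseteq>\<^bsub>ladder_domain\<^esub> node a l" if "k \<le> l" for l
  proof -
    have "ladder a k \<le> ladder a l" using ladder_le_iff[OF a] that by blast
    then show ?thesis
      using k \<open>a \<le> b\<close> a b nbhd_node_subset_iff by simp
  qed
  then show ?thesis using that by blast
qed

lemma nodes_below_point:
  assumes a: "limit a"
  shows "directed_in ladder_domain {x \<in> nodes. x \<sqsubseteq>\<^bsub>ladder_domain\<^esub> point a} \<and>
    is_Sup ladder_domain (point a) {x \<in> nodes. x \<sqsubseteq>\<^bsub>ladder_domain\<^esub> point a}"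
    (is "directed_in _ ?D \<and> _")
proof
  have node_D: "node a k \<in> ?D" for k using a ladder_less by simp
  have "\<exists>z\<in>?D. x \<sqsubseteq>\<^bsub>ladder_domain\<^esub> z \<and> y \<sqsubseteq>\<^bsub>ladder_domain\<^esub> z" if "x \<in> ?D" "y \<in> ?D" for x y
  proof -
    obtain k where k: "\<And>l. k \<le> l \<Longrightarrow> x \<sqsubseteq>\<^bsub>ladder_domain\<^esub> node a l"
      using node_below_point[OF a, of x] \<open>x \<in> ?D\<close> by blast
    obtain j where j: "\<And>l. j \<le> l \<Longrightarrow> y \<sqsubseteq>\<^bsub>ladder_domain\<^esub> node a l"
      using node_below_point[OF a, of y] \<open>y \<in> ?D\<close> by blast
    show ?thesis
      using k[of "max k j"] j[of "max k j"] node_D[of "max k j"]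
      by (intro bexI[of _ "node a (max k j)"] conjI) (simp_all only: max.cobounded1 max.cobounded2)
  qed
  then show "directed_in ladder_domain ?D"
    using node_D[of 0] unfolding directed_in_def carrier_ladder_domain by blast
  show "is_Sup ladder_domain (point a) ?D"
    using a node_D by (intro is_Sup_point) auto
qed

text \<open>
  The least right end \<open>a\<close> occurring in \<open>D\<close> is the limit. The nodes of \<open>D\<close> on the ladder of \<open>a\<close>
  are cofinal in \<open>D\<close>, and were there only finitely many, the topmost would be greatest in \<open>D\<close>.
\<close>
lemma directed_without_greatest:
  assumes D: "directed_in ladder_domain D"
    and no_greatest: "\<not> (\<exists>g\<in>D. \<forall>d\<in>D. d \<sqsubseteq>\<^bsub>ladder_domain\<^esub> g)"
  shows "\<exists>m. is_Sup ladder_domain m D \<and>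
    (\<forall>k\<in>nodes. k \<sqsubseteq>\<^bsub>ladder_domain\<^esub> m \<longrightarrow> (\<exists>d\<in>D. k \<sqsubseteq>\<^bsub>ladder_domain\<^esub> d))"
proof -
  have sub: "D \<subseteq> nodes \<union> points" and "D \<noteq> {}"
    using D unfolding directed_in_def by auto
  have dir: "\<exists>z\<in>D. x \<sqsubseteq>\<^bsub>ladder_domain\<^esub> z \<and> y \<sqsubseteq>\<^bsub>ladder_domain\<^esub> z" if "x \<in> D" "y \<in> D" for x y
    using D that unfolding directed_in_def by blast
  have "x \<notin> points" if "x \<in> D" for x
  proof
    assume "x \<in> points"
    then have "x \<in> Max_elements ladder_domain" by (simp add: Max_ladder_domain)
    then have "z = x" if "z \<in> D" "x \<sqsubseteq>\<^bsub>ladder_domain\<^esub> z" for z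
      using that sub unfolding Max_elements_def by auto
    then show False using dir[OF \<open>x \<in> D\<close>] no_greatest \<open>x \<in> D\<close> by metis
  qed
  then have D_nodes: "D \<subseteq> nodes" using sub by blast
  define a where "a = (LEAST a. limit a \<and> (\<exists>k. node a k \<in> D))"
  have "\<exists>a. limit a \<and> (\<exists>k. node a k \<in> D)"
    using D_nodes \<open>D \<noteq> {}\<close> unfolding nodes_def by blast
  then have "limit a \<and> (\<exists>k. node a k \<in> D)"
    unfolding a_def by (rule LeastI_ex)
  then obtain k0 where a: "limit a" and k0: "node a k0 \<in> D" by blast
  (* Right ends decrease along the order, so minimality of a pins them to a above node a k0. *)
  have above: "\<exists>l. node a l \<in> D \<and> d \<sqsubseteq>\<^bsub>ladder_domain\<^esub> node a l" if d: "d \<in> D" for d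
  proof -
    obtain z where z: "z \<in> D" "node a k0 \<sqsubseteq>\<^bsub>ladder_domain\<^esub> z" "d \<sqsubseteq>\<^bsub>ladder_domain\<^esub> z"
      using dir[OF k0 d] by blast
    then obtain b l where b: "limit b" "z = node b l" using D_nodes unfolding nodes_def by blast
    have "b \<le> a" using z b a nbhd_node_subset_iff le_ladder_domain by metis
    moreover have "a \<le> b" unfolding a_def using b z by (intro Least_le) blast
    ultimately show ?thesis using z b by force
  qed
  have cofinal: "\<exists>l\<ge>k. node a l \<in> D" for k
  proof (rule ccontr)
    assume "\<not> ?thesis"
    then have bound: "l \<le> k" if "node a l \<in> D" for l using that by (meson nat_le_linear)
    define m where "m = (GREATEST l. node a l \<in> D)"
    have m: "node a m \<in> D" unfolding m_def using GreatestI_nat[of "\<lambda>l. node a l \<in> D"] k0 bound by blast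
    have top: "l \<le> m" if "node a l \<in> D" for l
      unfolding m_def using Greatest_le_nat[of "\<lambda>l. node a l \<in> D"] that bound by blast
    have "node a l \<sqsubseteq>\<^bsub>ladder_domain\<^esub> node a m" if "node a l \<in> D" for l
      unfolding le_ladder_domain nbhd_node_subset_iff[OF a a] ladder_le_iff[OF a]
      using top[OF that] by simp
    then have "d \<sqsubseteq>\<^bsub>ladder_domain\<^esub> node a m" if "d \<in> D" for d
      using above[OF that] by auto
    then show False using no_greatest m by blast
  qed
  have "is_Sup ladder_domain (point a) D"
  proof (rule is_Sup_point[OF a])
    show "d \<sqsubseteq>\<^bsub>ladder_domain\<^esub> point a" if "d \<in> D" for d
      using above[OF that] ladder_less[OF a] by fastforce
  qed (use sub cofinal in auto)
  moreover have "\<exists>d\<in>D. x \<sqsubseteq>\<^bsub>ladder_domain\<^esub> d" if "x \<in> nodes" "x \<sqsubseteq>\<^bsub>ladder_domain\<^esub> point a" for x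
    using node_below_point[OF a that] cofinal by metis
  ultimately show ?thesis by blast
qed

lemma ideal_domain_ladder_domain: "ideal_domain ladder_domain"
proof (rule ideal_domain_criterion[where K = nodes])
  show "directed_in ladder_domain {k \<in> nodes. k \<sqsubseteq>\<^bsub>ladder_domain\<^esub> m} \<and>
      is_Sup ladder_domain m {k \<in> nodes. k \<sqsubseteq>\<^bsub>ladder_domain\<^esub> m}"
    if "m \<in> carrier ladder_domain - nodes" for m
  proof -
    have "m \<in> points" using that by auto
    then obtain a where "limit a" "m = point a"
      unfolding points_def by blast
    then show ?thesis using nodes_below_point by blast
  qed
qed (use partial_order_ladder_domain Max_ladder_domain directed_without_greatest in auto)

section \<open>The maximal elements do not form a G-delta set\<close>

text \<open>
  The open set chooses, for each limit, a rung of its ladder. Pressing down makes these choices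
  uniform: intervals starting at or before \<open>b\<close> and ending arbitrarily high belong to \<open>U\<close>, and so does
  everything above them in the order.
\<close>
lemma open_around_points_contains_tails:
  assumes U: "scott_open ladder_domain U" and sub: "points \<subseteq> U"
  shows "\<exists>b. \<forall>c k. limit c \<longrightarrow> b \<le> ladder c k \<longrightarrow> node c k \<in> U"
proof -
  have "\<exists>k. node a k \<in> U" if a: "limit a" for a
  proof -
    have "point a \<in> U" using a sub by auto
    then obtain x where x: "x \<in> U" "x \<in> nodes" "x \<sqsubseteq>\<^bsub>ladder_domain\<^esub> point a"
      using nodes_below_point[OF a] U unfolding scott_open_def by blast
    then obtain k where "x \<sqsubseteq>\<^bsub>ladder_domain\<^esub> node a k"
      using node_below_point[OF a] by blast
    moreover have "node a k \<in> carrier ladder_domain" using a by simp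
    ultimately have "node a k \<in> U" using x U unfolding scott_open_def by blast
    then show ?thesis ..
  qed
  then obtain k where k: "\<And>a. limit a \<Longrightarrow> node a (k a) \<in> U" by metis
  obtain b where b: "\<forall>c. \<exists>a\<ge>c. limit a \<and> ladder a (k a) \<le> b"
    using pressing_down[of "\<lambda>a. ladder a (k a)"] ladder_less by blast
  have "node c j \<in> U" if c: "limit c" and le: "b \<le> ladder c j" for c j
  proof -
    obtain a where a: "c \<le> a" "limit a" "ladder a (k a) \<le> b" using b by blast
    then have "node a (k a) \<sqsubseteq>\<^bsub>ladder_domain\<^esub> node c j"
      using c le nbhd_node_subset_iff by auto
    moreover have "node c j \<in> carrier ladder_domain" using c by simp
    ultimately show ?thesis using k[OF a(2)] U unfolding scott_open_def by blast
  qed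
  then show ?thesis by blast
qed

lemma not_gdelta_Max_ladder_domain:
  "\<not> gdelta_in (scott_topology ladder_domain) (Max_elements ladder_domain)"
proof
  assume "gdelta_in (scott_topology ladder_domain) (Max_elements ladder_domain)"
  then obtain \<U> where \<U>: "countable \<U>" "\<And>U. U \<in> \<U> \<Longrightarrow> scott_open ladder_domain U"
      "\<Inter>\<U> = points"
    unfolding gdelta_in_alt intersection_of_def Max_ladder_domain by fastforce
  then have "\<exists>b. \<forall>c k. limit c \<longrightarrow> b \<le> ladder c k \<longrightarrow> node c k \<in> U" if "U \<in> \<U>" for U
    using open_around_points_contains_tails that by blast
  then obtain b where b: "\<And>U c k. \<lbrakk>U \<in> \<U>; limit c; b U \<le> ladder c k\<rbrakk> \<Longrightarrow> node c k \<in> U"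
    by metis
  obtain b' where b': "\<And>n. b (from_nat_into \<U> n) < b'"
    using omega1_sequence_bounded[of "\<lambda>n. b (from_nat_into \<U> n)"] by blast
  obtain c where c: "limit c" "b' < c" by (rule limit_above)
  then obtain k where k: "b' < ladder c k" using ladder_cofinal[OF c] by metis
  have "node c k \<in> U" if U: "U \<in> \<U>" for U
  proof -
    obtain n where "from_nat_into \<U> n = U" using from_nat_into_surj[OF \<U>(1) U] ..
    then have "b U \<le> ladder c k" using b'[of n] k by simp
    then show ?thesis by (rule b[OF U c(1)])
  qed
  then have "node c k \<in> points" using \<U>(3) by blast
  then obtain a where "node c k = point a" unfolding points_def by blast
  then show False
    using nbhd_node_not_subset_point[OF c(1), of k a] by (metis nbhd_point subset_refl)
qed

theorem mainTheorem1:
  shows "\<exists>P :: (nat \<Rightarrow> nat) gorder.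
           ideal_domain P \<and> \<not> gdelta_in (scott_topology P) (Max_elements P)"
  using ideal_domain_ladder_domain not_gdelta_Max_ladder_domain by blast

end
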